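(* Let $s\ge0$ be an integer, $h\in\mathbb C\setminus\{0\}$, and let $q\in\mathbb C\setminus\{0\}$ be either $1$ or not a root of unity. Let $0\le k\le n$. If $s\ne1$ and $s\ne0$, then $$S_{s,h,q}[n,k]=\frac{h^{n-k}[s]_q^n}{[k]_{q^{1-s}}!\,[1-s]_q^k}\sum_{j=0}^k(-1)^{k-j}q^{\binom{k-j}2(1-s)}\genfrac{[}{]}{0pt}{}{k}{j}_{q^{1-s}}\prod_{t=1}^n[(j/s)+t-j-1]_{q^s}.$$ If $s=0$, then $$S_{0,h,q}[n,k]=\frac{h^{n-k}}{[k]_q!}\sum_{j=0}^k(-1)^{k-j}q^{\binom{k-j}2}\genfrac{[}{]}{0pt}{}{k}{j}_q[j]_q^n .$$
   Context: $[x]_p=\frac{p^x-1}{p-1}$ if $p\ne1$ and $[x]_1=x$; for the non-integer argument $x=(j/s)+t-j-1$ with $p=q^s$, the power $p^{x}$ means $q^{sx}=q^{j+s(t-j-1)}$. $[n]_p!=[n]_p[n-1]_p\cdots[1]_p$, and $\genfrac{[}{]}{0pt}{}{k}{j}_p=\frac{[k]_p!}{[j]_p!\,[k-j]_p!}$. $0^0=1$. The numbers $S_{s,h,q}[n,k]$ are the coefficients in $(VU)^n=\sum_{k=0}^nS_{s,h,q}[n,k]V^{sn-(s-1)k}U^k$, where $UV-qVU=hV^s$; equivalently they are determined by $S_{s,h,q}[n,k]=q^{s(n-1)-(s-1)(k-1)}S_{s,h,q}[n-1,k-1]+h[s(n-1)-(s-1)k]_q\,S_{s,h,q}[n-1,k]$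 for $n,k\ge1$, with $S_{s,h,q}[n,0]=S_{s,h,q}[0,n]=\delta_{0,n}$. *)

theory Defs
  imports Complex_Main "HOL-Library.Poly_Mapping"
begin

definition qbracket :: "complex \<Rightarrow> int \<Rightarrow> complex" where
  "qbracket p m = (if p = 1 then of_int m else (p powi m - 1) / (p - 1))"

(* The bracket [x]_p with p = q^s and s * x an integer; the power p^x is read as q^(s*x). *)
definition qbracket_root :: "complex \<Rightarrow> nat \<Rightarrow> rat \<Rightarrow> complex" where
  "qbracket_root q s x =
     (if q ^ s = 1 then of_rat x else (q powi \<lfloor>of_nat s * x\<rfloor> - 1) / (q ^ s - 1))"

definition qfact :: "complex \<Rightarrow> nat \<Rightarrow> complex" where
  "qfact p k = (\<Prod>i=1..k. qbracket p (int i))"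

definition qbinomial :: "complex \<Rightarrow> nat \<Rightarrow> nat \<Rightarrow> complex" where
  "qbinomial p k j = qfact p k / (qfact p j * qfact p (k - j))"


(* Words under concatenation form a monoid, written additively because the product on
   the type of finitely supported functions is the convolution over monoid_add. Hence
   free_alg is the free unital associative algebra on U and V. *)

datatype letter = LetU | LetV

datatype fword = FWord (letters: "letter list")

instantiation fword :: monoid_add
begin

definition "0 = FWord []"

definition "a + b = FWord (letters a @ letters b)"

instance
  by standard (simp_all add: zero_fword_def plus_fword_def)

end

type_synonym free_alg = "fword \<Rightarrow>\<^sub>0 complex"

definition genU :: free_alg where
  "genU = Poly_Mapping.single (FWord [LetU]) 1"

definition genV :: free_alg where
  "genV = Poly_Mapping.single (FWord [LetV]) 1"

definition scal :: "complex \<Rightarrow> free_alg" where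
  "scal c = Poly_Mapping.single 0 c"

(* The two-sided ideal generated by U V - q V U - h V^s. *)
inductive_set comm_ideal :: "nat \<Rightarrow> complex \<Rightarrow> complex \<Rightarrow> free_alg set"
  for s :: nat and h q :: complex where
  zero: "0 \<in> comm_ideal s h q"
| gen: "a * (genU * genV - scal q * genV * genU - scal h * genV ^ s) * b \<in> comm_ideal s h q"
| add: "a \<in> comm_ideal s h q \<Longrightarrow> b \<in> comm_ideal s h q \<Longrightarrow> a + b \<in> comm_ideal s h q"

(* (V U)^n = (\<Sum>k\<le>n. c k * V^(s n - (s-1) k) * U^k) in the algebra with generators U, V and
   the single relation U V - q V U = h V^s. *)
definition normal_ordered :: "nat \<Rightarrow> complex \<Rightarrow> complex \<Rightarrow> nat \<Rightarrow> (nat \<Rightarrow> complex) \<Rightarrow> bool" where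
  "normal_ordered s h q n c \<longleftrightarrow>
     (\<forall>k>n. c k = 0) \<and>
     (genV * genU) ^ n
       - (\<Sum>k\<le>n. scal (c k) * genV ^ nat (int s * int n - (int s - 1) * int k) * genU ^ k)
       \<in> comm_ideal s h q"

(* That such coefficients exist and are unique is proved in normal_ordered_ex1 below. *)
definition gstirling :: "nat \<Rightarrow> complex \<Rightarrow> complex \<Rightarrow> nat \<Rightarrow> nat \<Rightarrow> complex" where
  "gstirling s h q n = (THE c. normal_ordered s h q n c)"


subsection \<open>Arithmetic modulo the ideal\<close>

lemma ideal_mult:
  assumes "x \<in> comm_ideal s h q"
  shows "a * x * b \<in> comm_ideal s h q"
  using assms
proof (induction rule: comm_ideal.induct)
  case zero
  then show ?case by (simp add: comm_ideal.zero)
next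
  case (gen c d)
  have "(a * c) * (genU * genV - scal q * genV * genU - scal h * genV ^ s) * (d * b)
     \<in> comm_ideal s h q"
    by (rule comm_ideal.gen)
  then show ?case by (simp only: mult.assoc)
next
  case (add x y)
  then show ?case by (simp add: distrib_left distrib_right comm_ideal.add)
qed

lemma ideal_mult_left: "x \<in> comm_ideal s h q \<Longrightarrow> a * x \<in> comm_ideal s h q"
  using ideal_mult[of x s h q a 1] by simp

lemma ideal_mult_right: "x \<in> comm_ideal s h q \<Longrightarrow> x * b \<in> comm_ideal s h q"
  using ideal_mult[of x s h q 1 b] by simp

lemma ideal_uminus: "x \<in> comm_ideal s h q \<Longrightarrow> - x \<in> comm_ideal s h q"
  using ideal_mult_left[of x s h q "-1"] by simp

lemma ideal_diff:
  "x \<in> comm_ideal s h q \<Longrightarrow> y \<in> comm_ideal s h q \<Longrightarrow> x - y \<in> comm_ideal s h q"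
  using comm_ideal.add[OF _ ideal_uminus, of x s h q y] by simp

lemma ideal_sum:
  "(\<And>i. i \<in> A \<Longrightarrow> f i \<in> comm_ideal s h q) \<Longrightarrow> sum f A \<in> comm_ideal s h q"
  by (induction A rule: infinite_finite_induct) (auto intro: comm_ideal.zero comm_ideal.add)

lemma poly_mapping_single_sum:
  fixes p :: free_alg
  shows "p = (\<Sum>w\<in>Poly_Mapping.keys p. Poly_Mapping.single w (Poly_Mapping.lookup p w))"
proof (rule poly_mapping_eqI)
  fix v
  show "Poly_Mapping.lookup p v = Poly_Mapping.lookup
      (\<Sum>w\<in>Poly_Mapping.keys p. Poly_Mapping.single w (Poly_Mapping.lookup p w)) v"
    by (cases "v \<in> Poly_Mapping.keys p")
       (auto simp: lookup_sum lookup_single when_def sum.delta in_keys_iff)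
qed

lemma free_alg_induct [case_names zero single add]:
  fixes p :: free_alg
  assumes "P 0" "\<And>w c. P (Poly_Mapping.single w c)" "\<And>a b. P a \<Longrightarrow> P b \<Longrightarrow> P (a + b)"
  shows "P p"
proof -
  have "P (\<Sum>w\<in>A. Poly_Mapping.single w (Poly_Mapping.lookup p w))" for A
    by (induction A rule: infinite_finite_induct) (auto intro: assms)
  then show ?thesis
    by (metis poly_mapping_single_sum)
qed

lemma scal_commute: "a * scal c = scal c * a"
  by (induction a rule: free_alg_induct)
     (simp_all add: scal_def mult_single distrib_left distrib_right mult.commute)

lemma scal_commute_left: "a * (scal c * b) = scal c * (a * b)"
  by (metis mult.assoc scal_commute)

lemma scal_add: "scal (a + b) = scal a + scal b"
  by (simp add: scal_def single_add)

lemma scal_mult: "scal (a * b) = scal a * scal b"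
  by (simp add: scal_def mult_single)

lemma scal_0 [simp]: "scal 0 = 0"
  by (simp add: scal_def)

lemma scal_1 [simp]: "scal 1 = 1"
  by (simp add: scal_def)

lemma qbracket_0 [simp]: "qbracket q 0 = 0"
  by (simp add: qbracket_def)

lemma qbracket_Suc: "qbracket q (int (Suc m)) = 1 + q * qbracket q (int m)"
  by (auto simp: qbracket_def power_int_def nat_add_distrib field_simps)

lemma qbracket_Suc': "qbracket q (int (Suc m)) = q ^ m + qbracket q (int m)"
  by (auto simp: qbracket_def power_int_def nat_add_distrib field_simps)

lemma genU_genV_power:
  "genU * genV ^ m - (scal (q ^ m) * (genV ^ m * genU)
      + scal (h * qbracket q (int m)) * genV ^ (m + s - 1)) \<in> comm_ideal s h q"
proof (induction m)
  case 0
  then show ?case by (simp add: comm_ideal.zero)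
next
  case (Suc m)
  let ?I = "comm_ideal s h q"
  let ?r = "genU * genV - scal q * genV * genU - scal h * genV ^ s"
  let ?R = "scal (q ^ m) * (genV ^ m * genU) + scal (h * qbracket q (int m)) * genV ^ (m + s - 1)"
  have 1: "(genU * genV ^ m - ?R) * genV \<in> ?I"
    by (rule ideal_mult_right[OF Suc])
  have "(scal (q ^ m) * genV ^ m) * ?r * 1 \<in> ?I"
    by (rule comm_ideal.gen)
  then have 2: "(scal (q ^ m) * genV ^ m) * ?r \<in> ?I" by simp
  have p: "scal (h * qbracket q (int m)) * genV ^ (m + s - 1) * genV
      = scal (h * qbracket q (int m)) * genV ^ (m + s)"
  proof (cases m)
    case (Suc m')
    then show ?thesis by (simp add: mult.assoc power_commutes)
  qed simp
  have a: "genU * genV ^ m * genV = genU * genV ^ Suc m"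
    by (simp add: mult.assoc power_commutes)
  have eq: "(genU * genV ^ m - ?R) * genV + (scal (q ^ m) * genV ^ m) * ?r
     = genU * genV ^ Suc m - (scal (q ^ Suc m) * (genV ^ Suc m * genU)
        + scal (h * qbracket q (int (Suc m))) * genV ^ (Suc m + s - 1))"
  proof -
    have b: "scal (q ^ m) * genV ^ m * (scal q * genV * genU)
       = scal (q ^ Suc m) * (genV ^ Suc m * genU)"
    proof -
      have "scal (q ^ m) * genV ^ m * (scal q * genV * genU)
         = scal (q ^ m) * (genV ^ m * (scal q * (genV * genU)))"
        by (simp only: mult.assoc)
      also have "\<dots> = scal (q ^ m) * (scal q * (genV ^ m * (genV * genU)))"
        by (subst scal_commute_left[of "genV ^ m"]) (rule refl)
      also have "\<dots> = scal (q ^ m * q) * (genV ^ m * genV * genU)"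
        by (simp only: mult.assoc scal_mult)
      also have "q ^ m * q = q ^ Suc m" by (simp only: power_Suc2)
      also have "genV ^ m * genV = genV ^ Suc m" by (simp only: power_Suc2)
      finally show ?thesis .
    qed
    have c: "scal (q ^ m) * genV ^ m * (scal h * genV ^ s) = scal (h * q ^ m) * genV ^ (m + s)"
    proof -
      have "scal (q ^ m) * genV ^ m * (scal h * genV ^ s)
         = scal (q ^ m) * (scal h * (genV ^ m * genV ^ s))"
        by (simp only: mult.assoc) (subst scal_commute_left[of "genV ^ m"], rule refl)
      also have "\<dots> = scal (q ^ m * h) * (genV ^ m * genV ^ s)"
        by (simp only: mult.assoc scal_mult)
      also have "q ^ m * h = h * q ^ m" by (rule mult.commute)
      also have "genV ^ m * genV ^ s = genV ^ (m + s)" by (rule power_add[symmetric])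
      finally show ?thesis .
    qed
    have d: "scal (h * qbracket q (int (Suc m))) * genV ^ (Suc m + s - 1)
       = scal (h * q ^ m) * genV ^ (m + s) + scal (h * qbracket q (int m)) * genV ^ (m + s)"
      unfolding qbracket_Suc' by (simp add: distrib_left scal_add distrib_right)
    show ?thesis
      unfolding d a[symmetric] b[symmetric] c[symmetric] p[symmetric]
      by (simp only: left_diff_distrib right_diff_distrib distrib_right mult.assoc) simp
  qed
  show ?case
    using comm_ideal.add[OF 1 2] unfolding eq .
qed


subsection \<open>Existence and uniqueness of the coefficients\<close>

fun stirling_rec :: "nat \<Rightarrow> complex \<Rightarrow> complex \<Rightarrow> nat \<Rightarrow> nat \<Rightarrow> complex" where
  "stirling_rec s h q 0 k = (if k = 0 then 1 else 0)"
| "stirling_rec s h q (Suc n) 0 = 0"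
| "stirling_rec s h q (Suc n) (Suc k) =
     q powi (int s * int n - (int s - 1) * int k) * stirling_rec s h q n k
     + h * qbracket q (int s * int n - (int s - 1) * int (Suc k)) * stirling_rec s h q n (Suc k)"

lemma stirling_rec_eq_0: "k > n \<Longrightarrow> stirling_rec s h q n k = 0"
  by (induction s h q n k rule: stirling_rec.induct) auto

lemma exponent_eq:
  assumes "k \<le> n"
  shows "int s * int n - (int s - 1) * int k = int (s * (n - k) + k)"
proof -
  obtain d where "n = k + d" using assms le_Suc_ex by blast
  then show ?thesis by (simp add: algebra_simps)
qed

lemma stirling_rec_step_0:
  "h * qbracket q (int (s * n)) * stirling_rec s h q n 0 = 0"
  by (cases n) auto

lemma normal_ordered_stirling_rec: "normal_ordered s h q n (stirling_rec s h q n)"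
proof -
  let ?I = "comm_ideal s h q"
  let ?S = "stirling_rec s h q"
  let ?e = "\<lambda>n k. s * (n - k) + k"
  have "(genV * genU) ^ n - (\<Sum>k\<le>n. scal (?S n k) * genV ^ ?e n k * genU ^ k) \<in> ?I"
  proof (induction n)
    case 0
    then show ?case by (simp add: comm_ideal.zero)
  next
    case (Suc n)
    let ?N = "\<Sum>k\<le>n. scal (?S n k) * genV ^ ?e n k * genU ^ k"
    let ?b = "\<lambda>k. genU * genV ^ ?e n k - (scal (q ^ ?e n k) * (genV ^ ?e n k * genU)
        + scal (h * qbracket q (int (?e n k))) * genV ^ (?e n k + s - 1))"
    have 1: "(genV * genU) * ((genV * genU) ^ n - ?N) \<in> ?I"
      by (rule ideal_mult_left[OF Suc])
    have 2: "(\<Sum>k\<le>n. scal (?S n k) * (genV * ?b k * genU ^ k)) \<in> ?I"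
      by (intro ideal_sum ideal_mult_left ideal_mult genU_genV_power)
    let ?A = "\<lambda>k. scal (?S n k * q ^ ?e n k) * (genV ^ Suc (?e n k) * genU ^ Suc k)"
    let ?B = "\<lambda>k. scal (?S n k * (h * qbracket q (int (?e n k)))) * (genV ^ (?e n k + s) * genU ^ k)"
    have summand: "(genV * genU) * (scal (?S n k) * genV ^ ?e n k * genU ^ k)
        - scal (?S n k) * (genV * ?b k * genU ^ k) = ?A k + ?B k" for k
    proof -
      have x: "(genV * genU) * (scal (?S n k) * genV ^ ?e n k * genU ^ k)
         = scal (?S n k) * (genV * (genU * genV ^ ?e n k) * genU ^ k)"
        by (simp only: mult.assoc scal_commute_left)
      have y: "scal (?S n k) * (genV * (scal (q ^ ?e n k) * (genV ^ ?e n k * genU)) * genU ^ k) = ?A k"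
        by (simp only: mult.assoc scal_commute_left[of genV] scal_mult power_Suc)
      have z: "scal (?S n k) * (genV * (scal (h * qbracket q (int (?e n k)))
           * genV ^ (?e n k + s - 1)) * genU ^ k) = ?B k"
      proof (cases "?e n k = 0")
        case True
        show ?thesis unfolding True by simp
      next
        case False
        then have "?e n k + s = Suc (?e n k + s - 1)" by linarith
        then have v: "genV ^ (?e n k + s) = genV * genV ^ (?e n k + s - 1)"
          by (metis power_Suc)
        show ?thesis
          unfolding v by (simp only: mult.assoc scal_commute_left[of genV] scal_mult)
      qed
      show ?thesis
        unfolding x y[symmetric] z[symmetric] 
        by (simp only: distrib_left distrib_right left_diff_distrib right_diff_distrib) simp
    qed
    have "(genV * genU) * ((genV * genU) ^ n - ?N)
        + (\<Sum>k\<le>n. scal (?S n k) * (genV * ?b k * genU ^ k))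
        = (genV * genU) ^ Suc n - (\<Sum>k\<le>n. ?A k + ?B k)"
      unfolding summand[symmetric] by (simp add: right_diff_distrib sum_distrib_left sum_subtractf)
    also have "(\<Sum>k\<le>n. ?A k + ?B k)
        = (\<Sum>k\<le>Suc n. scal (?S (Suc n) k) * genV ^ ?e (Suc n) k * genU ^ k)"
    proof -
      let ?C = "\<lambda>k. scal (q ^ ?e n k * ?S n k) * (genV ^ ?e (Suc n) (Suc k) * genU ^ Suc k)"
      let ?D = "\<lambda>k. scal (h * qbracket q (int s * int n - (int s - 1) * int k) * ?S n k)
          * (genV ^ ?e (Suc n) k * genU ^ k)"
      have A: "?A k = ?C k" for k by (simp add: mult.commute)
      have B: "?B k = ?D k" if "k \<le> n" for k
      proof -
        have "?e n k + s = ?e (Suc n) k" using that by (simp add: Suc_diff_le)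
        moreover have "?S n k * (h * qbracket q (int (?e n k)))
            = h * qbracket q (int s * int n - (int s - 1) * int k) * ?S n k"
          unfolding exponent_eq[OF that] by (simp only: mult_ac)
        ultimately show ?thesis by (simp only:)
      qed
      have D0: "?D 0 = 0"
        using stirling_rec_step_0[of h q s n] by auto
      have Dn: "?D (Suc n) = 0"
        by (simp add: stirling_rec_eq_0)
      have CD: "?C k + ?D (Suc k)
          = scal (?S (Suc n) (Suc k)) * genV ^ ?e (Suc n) (Suc k) * genU ^ Suc k" if "k \<le> n" for k
        using exponent_eq[OF that, of s]
        by (simp add: scal_add distrib_right mult.assoc del: of_nat_add of_nat_mult)
      have "(\<Sum>k\<le>n. ?A k + ?B k) = (\<Sum>k\<le>n. ?C k) + (\<Sum>k\<le>n. ?D k)"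
        unfolding sum.distrib using A B by simp
      also have "(\<Sum>k\<le>n. ?D k) = (\<Sum>k\<le>Suc n. ?D k)"
        by (simp only: sum.atMost_Suc Dn add_0_right)
      also have "\<dots> = (\<Sum>k\<le>n. ?D (Suc k))"
        by (simp only: sum.atMost_Suc_shift D0 add_0_left)
      also have "(\<Sum>k\<le>n. ?C k) + (\<Sum>k\<le>n. ?D (Suc k))
          = (\<Sum>k\<le>n. scal (?S (Suc n) (Suc k)) * genV ^ ?e (Suc n) (Suc k) * genU ^ Suc k)"
        unfolding sum.distrib[symmetric] by (rule sum.cong[OF refl]) (rule CD, simp)
      also have "\<dots> = (\<Sum>k\<le>Suc n. scal (?S (Suc n) k) * genV ^ ?e (Suc n) k * genU ^ k)"
        by (simp only: sum.atMost_Suc_shift stirling_rec.simps(2) scal_0 mult_zero_left add_0_left)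
      finally show ?thesis .
    qed
    finally show ?case
      using comm_ideal.add[OF 1 2] by simp
  qed
  moreover have "(\<Sum>k\<le>n. scal (?S n k) * genV ^ nat (int s * int n - (int s - 1) * int k) * genU ^ k)
      = (\<Sum>k\<le>n. scal (?S n k) * genV ^ ?e n k * genU ^ k)"
    by (rule sum.cong[OF refl]) (simp only: exponent_eq atMost_iff nat_int)
  ultimately show ?thesis
    by (simp add: normal_ordered_def stirling_rec_eq_0)
qed

(* A right module over the presented algebra, used to separate the monomials V^i U^k. *)
fun act_letter :: "nat \<Rightarrow> complex \<Rightarrow> complex \<Rightarrow> letter \<Rightarrow> (nat \<Rightarrow> nat \<Rightarrow> complex) \<Rightarrow> nat \<Rightarrow> nat \<Rightarrow> complex" where
  "act_letter s h q LetV f i k = f (Suc i) k"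
| "act_letter s h q LetU f i k = q ^ i * f i (Suc k) + h * qbracket q (int i) * f (i + s - 1) k"

definition act_word :: "nat \<Rightarrow> complex \<Rightarrow> complex \<Rightarrow> fword \<Rightarrow> (nat \<Rightarrow> nat \<Rightarrow> complex) \<Rightarrow> nat \<Rightarrow> nat \<Rightarrow> complex" where
  "act_word s h q w f = fold (act_letter s h q) (letters w) f"

definition act :: "nat \<Rightarrow> complex \<Rightarrow> complex \<Rightarrow> free_alg \<Rightarrow> (nat \<Rightarrow> nat \<Rightarrow> complex) \<Rightarrow> nat \<Rightarrow> nat \<Rightarrow> complex" where
  "act s h q p f i k = (\<Sum>w. Poly_Mapping.lookup p w * act_word s h q w f i k)"

context
  fixes s :: nat and h q :: complex
begin

lemma act_letter_linear:
  "act_letter s h q l (\<lambda>i k. a * f i k + b * g i k)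
     = (\<lambda>i k. a * act_letter s h q l f i k + b * act_letter s h q l g i k)"
  by (cases l) (auto simp: fun_eq_iff algebra_simps)

lemma act_word_linear:
  "act_word s h q w (\<lambda>i k. a * f i k + b * g i k)
     = (\<lambda>i k. a * act_word s h q w f i k + b * act_word s h q w g i k)"
proof -
  have "fold (act_letter s h q) ls (\<lambda>i k. a * f i k + b * g i k)
     = (\<lambda>i k. a * fold (act_letter s h q) ls f i k + b * fold (act_letter s h q) ls g i k)" for ls
    by (induction ls arbitrary: f g) (simp_all add: act_letter_linear)
  then show ?thesis by (simp add: act_word_def)
qed

lemma act_zero [simp]: "act s h q 0 f = (\<lambda>i k. 0)"
  by (simp add: act_def fun_eq_iff)

lemma act_single: "act s h q (Poly_Mapping.single w c) f = (\<lambda>i k. c * act_word s h q w f i k)"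
proof (intro ext)
  fix i k
  have "(\<Sum>v. Poly_Mapping.lookup (Poly_Mapping.single w c) v * act_word s h q v f i k)
     = (\<Sum>v. c * act_word s h q v f i k when v = w)"
    by (rule Sum_any.cong) (auto simp: lookup_single when_def)
  then show "act s h q (Poly_Mapping.single w c) f i k = c * act_word s h q w f i k"
    by (simp add: act_def)
qed

lemma act_add: "act s h q (a + b) f = (\<lambda>i k. act s h q a f i k + act s h q b f i k)"
proof (intro ext)
  fix i k
  have fin: "finite {w. Poly_Mapping.lookup p w * act_word s h q w f i k \<noteq> 0}" for p
    by (rule finite_subset[OF _ finite_lookup[of p]]) auto
  show "act s h q (a + b) f i k = act s h q a f i k + act s h q b f i k"
    unfolding act_def lookup_add distrib_right
    by (rule Sum_any.distrib) (rule fin)+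
qed

lemma act_linear:
  "act s h q p (\<lambda>i k. a * f i k + b * g i k)
     = (\<lambda>i k. a * act s h q p f i k + b * act s h q p g i k)"
  by (induction p rule: free_alg_induct)
     (simp_all add: act_single act_add act_word_linear fun_eq_iff algebra_simps)

lemma act_linear_scale: "act s h q p (\<lambda>i k. a * f i k) = (\<lambda>i k. a * act s h q p f i k)"
  using act_linear[of p a f 0 f] by simp

lemma act_linear_add:
  "act s h q p (\<lambda>i k. f i k + g i k) = (\<lambda>i k. act s h q p f i k + act s h q p g i k)"
  using act_linear[of p 1 f 1 g] by simp

lemma act_linear_zero: "act s h q p (\<lambda>i k. 0) = (\<lambda>i k. 0)"
  using act_linear_scale[of p 0] by simp

lemma act_mult: "act s h q (a * b) f = act s h q b (act s h q a f)"
proof (induction a rule: free_alg_induct)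
  case zero
  then show ?case by (simp add: act_linear_zero)
next
  case (add a a')
  then show ?case by (simp add: distrib_right act_add act_linear_add)
next
  case (single w c)
  show ?case
  proof (induction b rule: free_alg_induct)
    case zero
    then show ?case by simp
  next
    case (add b b')
    then show ?case by (simp add: distrib_left act_add)
  next
    case (single v d)
    have w: "act_word s h q (w + v) f = act_word s h q v (act_word s h q w f)"
      by (simp add: act_word_def plus_fword_def)
    have l: "act_word s h q v (\<lambda>i k. c * g i k) = (\<lambda>i k. c * act_word s h q v g i k)" for g
      using act_word_linear[of v c g 0 g] by simp
    show ?case by (simp add: mult_single act_single w l mult_ac)
  qed
qed

lemma act_uminus: "act s h q (- a) f = (\<lambda>i k. - act s h q a f i k)"
proof -
  have "act s h q (a + - a) f = (\<lambda>i k. act s h q a f i k + act s h q (- a) f i k)"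
    by (rule act_add)
  then show ?thesis by (simp add: fun_eq_iff add_eq_0_iff)
qed

lemma act_diff: "act s h q (a - b) f = (\<lambda>i k. act s h q a f i k - act s h q b f i k)"
  using act_add[of a "- b" f] by (simp add: act_uminus)

lemma act_scal: "act s h q (scal c) f = (\<lambda>i k. c * f i k)"
  by (simp add: scal_def act_single act_word_def zero_fword_def)

lemma act_genV: "act s h q genV f = (\<lambda>i k. f (Suc i) k)"
  by (simp add: genV_def act_single act_word_def fun_eq_iff)

lemma act_genU:
  "act s h q genU f = (\<lambda>i k. q ^ i * f i (Suc k) + h * qbracket q (int i) * f (i + s - 1) k)"
  by (simp add: genU_def act_single act_word_def fun_eq_iff)

lemma act_one: "act s h q 1 f = f"
  using act_scal[of 1 f] by simp

lemma act_genV_power: "act s h q (genV ^ m) f = (\<lambda>i k. f (i + m) k)"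
  by (induction m arbitrary: f) (simp_all add: act_one act_mult act_genV)

lemma act_genU_power: "act s h q (genU ^ m) f 0 k = f 0 (k + m)"
  by (induction m arbitrary: f) (simp_all add: act_one act_mult act_genU)

lemma act_sum: "act s h q (sum p A) f i k = (\<Sum>x\<in>A. act s h q (p x) f i k)"
  by (induction A rule: infinite_finite_induct) (simp_all add: act_add)

lemma act_relation:
  "act s h q (genU * genV - scal q * genV * genU - scal h * genV ^ s) f = (\<lambda>i k. 0)"
proof -
  have 1: "act s h q (genU * genV) f i k
      = q ^ Suc i * f (Suc i) (Suc k) + h * (1 + q * qbracket q (int i)) * f (i + s) k" for i k
    using qbracket_Suc[of q i] by (simp add: act_mult act_genU act_genV)
  have 2: "act s h q (scal q * genV * genU) f i k
      = q ^ i * (q * f (Suc i) (Suc k)) + h * qbracket q (int i) * (q * f (i + s) k)" for i k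
    by (cases i) (simp_all add: act_mult act_genU act_genV act_scal)
  have 3: "act s h q (scal h * genV ^ s) f i k = h * f (i + s) k" for i k
    by (simp add: act_mult act_genV_power act_scal)
  show ?thesis
    by (simp add: act_diff 1 2 3 fun_eq_iff) (simp add: algebra_simps)
qed

lemma act_ideal:
  assumes "x \<in> comm_ideal s h q"
  shows "act s h q x f = (\<lambda>i k. 0)"
  using assms
  by (induction rule: comm_ideal.induct)
     (simp_all add: act_mult act_relation act_linear_zero act_add)

lemma normal_ordered_unique:
  assumes "normal_ordered s h q n c" "normal_ordered s h q n d"
  shows "c = d"
proof (rule ext)
  fix k
  let ?N = "\<lambda>c. \<Sum>k\<le>n. scal (c k) * genV ^ nat (int s * int n - (int s - 1) * int k) * genU ^ k"
  show "c k = d k"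
  proof (cases "k \<le> n")
    case False
    then show ?thesis using assms by (simp add: normal_ordered_def)
  next
    case True
    define f :: "nat \<Rightarrow> nat \<Rightarrow> complex" where "f = (\<lambda>i l. if l = k then 1 else 0)"
    have coeff: "act s h q (?N b) f 0 0 = b k" for b
    proof -
      have "act s h q (?N b) f 0 0 = (\<Sum>l\<le>n. if l = k then b l else 0)"
        unfolding act_sum
        by (rule sum.cong[OF refl]) (simp add: act_mult act_scal act_genV_power act_genU_power f_def)
      then show ?thesis using True by simp
    qed
    have "((genV * genU) ^ n - ?N d) - ((genV * genU) ^ n - ?N c) \<in> comm_ideal s h q"
      using assms unfolding normal_ordered_def by (elim conjE) (rule ideal_diff)
    then have "?N c - ?N d \<in> comm_ideal s h q" by simp
    from act_ideal[OF this, of f] have "act s h q (?N c) f 0 0 - act s h q (?N d) f 0 0 = 0"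
      by (simp add: act_diff fun_eq_iff)
    then show ?thesis unfolding coeff by simp
  qed
qed

lemma normal_ordered_ex1: "\<exists>!c. normal_ordered s h q n c"
  using normal_ordered_stirling_rec normal_ordered_unique by blast

lemma gstirling_normal_ordered: "normal_ordered s h q n (gstirling s h q n)"
  unfolding gstirling_def by (rule theI'[OF normal_ordered_ex1])

lemma gstirling_eq_rec: "gstirling s h q n k = stirling_rec s h q n k"
  using normal_ordered_unique[OF gstirling_normal_ordered normal_ordered_stirling_rec] by simp

end

end

theory Submission
  imports Defs
begin

text \<open>With \<open>d = 1 - s\<close>, both formulas say that the coefficient of \<open>V^(s n - (s-1) k) U^k\<close> is
  \<open>h^(n-k) \<Sum>j\<le>k. a (k-j) / B j * (\<Prod>t<n. [s t + d j]_q)\<close>, where \<open>B j = [d]_q \<cdots> [d j]_q\<close> and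
  \<open>a i = (-1)^i q^(d (i choose 2)) / B i\<close>.  The recurrence in \<open>n\<close> holds term by term: multiplying
  the summand by \<open>[s n + d j] - [s n + d k] = - q^(s n + d j) [d (k-j)]\<close> lowers \<open>k\<close> by one, because
  \<open>a (i+1) [d (i+1)] = - q^(d i) a i\<close>.  The same relation, applied to
  \<open>[d k] = [d j] + q^(d j) [d (k-j)]\<close>, makes the sum for \<open>n = 0\<close> vanish unless \<open>k = 0\<close>.\<close>

section \<open>Arithmetic of q-brackets at integer arguments\<close>

lemma qbracket_add: "q \<noteq> 0 \<Longrightarrow> qbracket q (x + y) = qbracket q x + q powi x * qbracket q y"
  by (auto simp: qbracket_def power_int_add add_divide_distrib[symmetric] right_diff_distrib)

lemma qbracket_mult:
  assumes "q powi d = 1 \<longrightarrow> q = 1"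
  shows "qbracket q (d * x) = qbracket (q powi d) x * qbracket q d"
proof (cases "q = 1")
  case False
  with assms show ?thesis by (simp add: qbracket_def power_int_mult)
qed (simp add: qbracket_def)

text \<open>The hypothesis speaks of positive exponents only; for \<open>i < 0\<close> the power is
  one of \<open>inverse q\<close>, which is 1 exactly when \<open>q ^ nat (- i)\<close> is.\<close>

lemma power_int_neq_1:
  fixes q :: complex
  assumes "\<forall>m::nat. m > 0 \<longrightarrow> q ^ m \<noteq> 1" and "i \<noteq> 0"
  shows "q powi i \<noteq> 1"
  using assms by (auto simp: power_int_def power_inverse inverse_eq_1_iff)

section \<open>The explicit sum and its coefficients\<close>

definition qfact_step :: "complex \<Rightarrow> int \<Rightarrow> nat \<Rightarrow> complex" where
  "qfact_step q d k = (\<Prod>i=1..k. qbracket q (d * int i))"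

text \<open>A rescaled q-exponential to the base \<open>q powi d\<close>: if no factor of the
  \<open>B j\<close> vanishes, the series with coefficients \<open>alt_coeff q d i\<close> is the
  reciprocal of the one with coefficients \<open>1 / B j\<close>.\<close>

definition alt_coeff :: "complex \<Rightarrow> int \<Rightarrow> nat \<Rightarrow> complex" where
  "alt_coeff q d i = (-1) ^ i * q powi (d * int (i choose 2)) / qfact_step q d i"

text \<open>For \<open>d = 1 - s\<close> the argument \<open>s t + d j\<close> is \<open>s\<close>
  times \<open>j/s + (t+1) - j - 1\<close>. Clearing the denominator keeps all arguments integral
  and lets \<open>s = 0\<close> be treated together with \<open>s > 1\<close>.\<close>

definition alt_sum :: "complex \<Rightarrow> int \<Rightarrow> int \<Rightarrow> nat \<Rightarrow> nat \<Rightarrow> complex" where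
  "alt_sum q s d n k = (\<Sum>j\<le>k. alt_coeff q d (k - j) / qfact_step q d j
     * (\<Prod>t<n. qbracket q (s * int t + d * int j)))"

lemma qfact_step_0 [simp]: "qfact_step q d 0 = 1"
  by (simp add: qfact_step_def)

lemma qfact_step_Suc: "qfact_step q d (Suc k) = qbracket q (d * int (Suc k)) * qfact_step q d k"
  by (simp add: qfact_step_def mult.commute)

lemma qfact_step_eq:
  assumes "q powi d = 1 \<longrightarrow> q = 1"
  shows "qfact_step q d k = qfact (q powi d) k * qbracket q d ^ k"
  by (induction k) (simp_all add: qfact_def qfact_step_Suc qbracket_mult[OF assms] del: of_nat_Suc)

context
  fixes q :: complex and d :: int
  assumes q0: "q \<noteq> 0" and nz: "\<And>i. i > 0 \<Longrightarrow> qbracket q (d * int i) \<noteq> 0"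
begin

lemma qfact_step_nonzero: "qfact_step q d k \<noteq> 0"
  using nz by (simp add: qfact_step_def)

lemma alt_coeff_Suc:
  "alt_coeff q d (Suc i) * qbracket q (d * int (Suc i)) = - (q powi (d * int i) * alt_coeff q d i)"
proof -
  have "Suc i choose 2 = i + (i choose 2)"
    by (simp add: numeral_2_eq_2)
  then have "q powi (d * int (Suc i choose 2)) = q powi (d * int i) * q powi (d * int (i choose 2))"
    using q0 by (simp add: distrib_left power_int_add)
  then show ?thesis
    using nz[of "Suc i"] qfact_step_nonzero[of i]
    by (simp add: alt_coeff_def qfact_step_Suc del: of_nat_Suc)
qed

lemma alt_sum_0: "alt_sum q s d 0 k = (if k = 0 then 1 else 0)"
proof (induction k)
  case 0
  then show ?case by (simp add: alt_sum_def alt_coeff_def binomial_eq_0)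
next
  case (Suc k)
  let ?a = "alt_coeff q d" and ?B = "qfact_step q d" and ?b = "\<lambda>i. qbracket q (d * int i)"
  let ?f = "\<lambda>j. ?a (Suc k - j) / ?B j"
  have split: "?b (Suc k) * ?f j = ?b j * ?f j + q powi (d * int j) * ?b (Suc k - j) * ?f j"
    if "j \<le> Suc k" for j
  proof -
    have "d * int (Suc k) = d * int j + d * int (Suc k - j)"
      using that by (simp add: of_nat_diff algebra_simps)
    then show ?thesis
      by (simp only: qbracket_add[OF q0]) (simp only: distrib_right)
  qed
  \<comment> \<open>The term \<open>j = 0\<close> drops out since \<open>[0] = 0\<close>; in the
    others \<open>[d j]\<close> cancels the last factor of \<open>B j\<close>, and \<open>j\<close>
    shifts by one.\<close>
  have "(\<Sum>j\<le>Suc k. ?b j * ?f j) = (\<Sum>j\<le>k. ?a (k - j) / ?B j)"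
    using nz unfolding sum.atMost_Suc_shift by (simp add: qfact_step_Suc del: of_nat_Suc)
  \<comment> \<open>Here the term \<open>j = Suc k\<close> drops out by \<open>[0] = 0\<close>; in
    the others \<open>q^(d j)\<close> and \<open>q^(d (k-j))\<close> merge into a factor free of
    \<open>j\<close>.\<close>
  moreover have "(\<Sum>j\<le>Suc k. q powi (d * int j) * ?b (Suc k - j) * ?f j)
      = (\<Sum>j\<le>k. - (q powi (d * int k)) * (?a (k - j) / ?B j))"
  proof -
    have "q powi (d * int j) * ?b (Suc k - j) * ?f j = - (q powi (d * int k)) * (?a (k - j) / ?B j)"
      if "j \<le> k" for j
    proof -
      have e: "q powi (d * int k) = q powi (d * int j) * q powi (d * int (k - j))"
        using that by (simp add: power_int_add[symmetric] q0 of_nat_diff algebra_simps)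
      have "q powi (d * int j) * ?b (Suc k - j) * ?f j
          = q powi (d * int j) * (?a (Suc (k - j)) * ?b (Suc (k - j))) / ?B j"
        using that by (simp add: Suc_diff_le del: of_nat_Suc)
      then show ?thesis unfolding alt_coeff_Suc e by simp
    qed
    then show ?thesis by (simp add: sum.atMost_Suc)
  qed
  moreover have "?b (Suc k) * (\<Sum>j\<le>Suc k. ?f j) = (\<Sum>j\<le>Suc k. ?b j * ?f j)
      + (\<Sum>j\<le>Suc k. q powi (d * int j) * ?b (Suc k - j) * ?f j)"
    unfolding sum_distrib_left sum.distrib[symmetric]
    by (rule sum.cong[OF refl]) (rule split, simp)
  ultimately have "?b (Suc k) * (\<Sum>j\<le>Suc k. ?f j)
      = (1 - q powi (d * int k)) * (\<Sum>j\<le>k. ?a (k - j) / ?B j)"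
    by (simp only: sum_distrib_left[symmetric] left_diff_distrib) simp
  \<comment> \<open>For \<open>k = 0\<close> the factor \<open>1 - q^0\<close> vanishes, for
    \<open>k > 0\<close> the sum does by induction.\<close>
  also have "\<dots> = 0"
    using Suc.IH by (auto simp: alt_sum_def)
  finally show ?case
    using nz[of "Suc k"] by (simp add: alt_sum_def del: of_nat_Suc sum.atMost_Suc)
qed

section \<open>Recurrence in \<open>n\<close> and comparison with the normal-ordering
  coefficients\<close>

lemma alt_sum_Suc_0: "alt_sum q s d (Suc n) 0 = 0"
  \<comment> \<open>Only \<open>j = 0\<close> occurs, and its factor at \<open>t = 0\<close> is
    \<open>[0]\<close>.\<close>
  by (simp add: alt_sum_def prod.lessThan_Suc_shift del: prod.lessThan_Suc)

lemma alt_sum_Suc_Suc: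
  "alt_sum q s d (Suc n) (Suc k) = q powi (s * int n + d * int k) * alt_sum q s d n k
     + qbracket q (s * int n + d * int (Suc k)) * alt_sum q s d n (Suc k)"
proof -
  let ?a = "alt_coeff q d" and ?B = "qfact_step q d"
  let ?P = "\<lambda>j. \<Prod>t<n. qbracket q (s * int t + d * int j)"
  let ?e = "\<lambda>j. s * int n + d * int j"
  have step: "?a (Suc k - j) / ?B j * (?P j * qbracket q (?e j))
      = q powi ?e k * (?a (k - j) / ?B j * ?P j)
        + qbracket q (?e (Suc k)) * (?a (Suc k - j) / ?B j * ?P j)" if "j \<le> k" for j
  proof -
    have "?e (Suc k) = ?e j + d * int (Suc (k - j))"
      using that by (simp add: of_nat_diff algebra_simps)
    then have "qbracket q (?e (Suc k))
        = qbracket q (?e j) + q powi ?e j * qbracket q (d * int (Suc (k - j)))"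
      by (simp only: qbracket_add[OF q0])
    moreover have "q powi ?e k = q powi ?e j * q powi (d * int (k - j))"
      using that by (simp add: power_int_add[symmetric] q0 of_nat_diff algebra_simps)
    moreover have "Suc k - j = Suc (k - j)"
      using that by (rule Suc_diff_le)
    ultimately have "qbracket q (?e (Suc k)) * ?a (Suc k - j)
        = ?a (Suc k - j) * qbracket q (?e j)
          + q powi ?e j * (?a (Suc (k - j)) * qbracket q (d * int (Suc (k - j))))"
      and e: "q powi ?e k = q powi ?e j * q powi (d * int (k - j))"
      by (simp_all only: distrib_left distrib_right mult_ac)
    then have "qbracket q (?e (Suc k)) * ?a (Suc k - j)
        = ?a (Suc k - j) * qbracket q (?e j) - q powi ?e k * ?a (k - j)"
      unfolding alt_coeff_Suc by simp
    then have "(q powi ?e k * ?a (k - j) + qbracket q (?e (Suc k)) * ?a (Suc k - j)) / ?B j * ?P j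
        = ?a (Suc k - j) * qbracket q (?e j) / ?B j * ?P j"
      by (simp del: of_nat_Suc)
    then show ?thesis
      by (simp only: add_divide_distrib distrib_left distrib_right times_divide_eq_right times_divide_eq_left mult_ac)
  qed
  \<comment> \<open>The term \<open>j = Suc k\<close> is split off: its new factor already is
    \<open>[s n + d (k+1)]\<close>, and \<open>alt_sum q s d n k\<close> has no such term.\<close>
  have "alt_sum q s d (Suc n) (Suc k)
      = (\<Sum>j\<le>k. ?a (Suc k - j) / ?B j * (?P j * qbracket q (?e j)))
        + ?a 0 / ?B (Suc k) * (?P (Suc k) * qbracket q (?e (Suc k)))"
    by (simp add: alt_sum_def)
  also have "(\<Sum>j\<le>k. ?a (Suc k - j) / ?B j * (?P j * qbracket q (?e j)))
      = (\<Sum>j\<le>k. q powi ?e k * (?a (k - j) / ?B j * ?P j)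
        + qbracket q (?e (Suc k)) * (?a (Suc k - j) / ?B j * ?P j))"
    by (rule sum.cong[OF refl]) (rule step, simp)
  finally show ?thesis
    by (simp add: alt_sum_def sum.distrib sum_distrib_left distrib_left mult_ac
          del: of_nat_Suc)
qed

text \<open>Powers of \<open>h\<close> stand on both sides because the induction ranges over all
  \<open>k\<close>, and \<open>h ^ (n - k)\<close> would be truncated for
  \<open>k > n\<close>.\<close>

lemma stirling_rec_alt_sum:
  assumes "d = 1 - int s"
  shows "h ^ k * stirling_rec s h q n k = h ^ n * alt_sum q (int s) d n k"
proof (induction n arbitrary: k)
  case 0
  then show ?case by (simp add: alt_sum_0)
next
  case (Suc n)
  show ?case
  proof (cases k)
    case 0
    then show ?thesis by (simp add: alt_sum_Suc_0)
  next
    case (Suc k')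
    have e: "int s * int n - (int s - 1) * int i = int s * int n + d * int i" for i
      unfolding assms by (simp add: algebra_simps)
    have "h ^ Suc k' * stirling_rec s h q (Suc n) (Suc k')
        = h * q powi (int s * int n + d * int k') * (h ^ k' * stirling_rec s h q n k')
          + h * qbracket q (int s * int n + d * int (Suc k'))
              * (h ^ Suc k' * stirling_rec s h q n (Suc k'))"
      unfolding stirling_rec.simps(3) e by (simp only: power_Suc distrib_left mult_ac)
    also have "\<dots> = h ^ Suc n * alt_sum q (int s) d (Suc n) (Suc k')"
      unfolding Suc.IH alt_sum_Suc_Suc by (simp only: power_Suc distrib_left mult_ac)
    finally show ?thesis using Suc by simp
  qed
qed

lemma gstirling_alt_sum:
  assumes "d = 1 - int s" and "h \<noteq> 0" and "k \<le> n"
  shows "gstirling s h q n k = h ^ (n - k) * alt_sum q (int s) d n k"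
proof -
  have "h ^ k * gstirling s h q n k = h ^ k * (h ^ (n - k) * alt_sum q (int s) d n k)"
    using stirling_rec_alt_sum[OF assms(1), of h k n] assms(3)
    by (simp add: gstirling_eq_rec mult.assoc[symmetric] power_add[symmetric])
  then show ?thesis using assms(2) by simp
qed

end

section \<open>Passage to q-binomials and fractional brackets\<close>

lemma alt_sum_qbinomial:
  assumes "q \<noteq> 0" and nz: "\<And>i. i > 0 \<Longrightarrow> qbracket q (d * int i) \<noteq> 0"
    and root: "q powi d = 1 \<longrightarrow> q = 1"
  shows "alt_sum q s d n k = (\<Sum>j=0..k. (-1) ^ (k - j) * q powi (int ((k - j) choose 2) * d)
       * qbinomial (q powi d) k j * (\<Prod>t<n. qbracket q (s * int t + d * int j)))
     / (qfact (q powi d) k * qbracket q d ^ k)"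
proof -
  have bd: "qbracket q d \<noteq> 0"
    using nz[of 1] by simp
  have fn: "qfact (q powi d) i \<noteq> 0" for i
    using qfact_step_nonzero[OF assms(1) nz, of i] qfact_step_eq[OF root, of i] by auto
  show ?thesis
    unfolding alt_sum_def sum_divide_distrib atLeast0AtMost
  proof (rule sum.cong[OF refl])
    fix j assume "j \<in> {..k}"
    \<comment> \<open>As \<open>B i = [i]! [d]^i\<close>, the powers of \<open>[d]\<close> in
      \<open>B j\<close> and \<open>B (k-j)\<close> combine to \<open>[d]^k\<close>, while dividing
      the q-binomial by \<open>[k]!\<close> leaves \<open>1 / ([j]! [k-j]!)\<close>.\<close>
    then have "qbracket q d ^ k = qbracket q d ^ j * qbracket q d ^ (k - j)"
      by (simp add: power_add[symmetric])
    then show "alt_coeff q d (k - j) / qfact_step q d j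
          * (\<Prod>t<n. qbracket q (s * int t + d * int j))
        = (-1) ^ (k - j) * q powi (int ((k - j) choose 2) * d) * qbinomial (q powi d) k j
          * (\<Prod>t<n. qbracket q (s * int t + d * int j))
          / (qfact (q powi d) k * qbracket q d ^ k)"
      using bd fn by (simp add: alt_coeff_def qbinomial_def qfact_step_eq[OF root] mult_ac)
  qed
qed

text \<open>Since \<open>s * x\<close> is an integer, the floor in \<open>qbracket_root\<close> is
  exact, and for \<open>q \<noteq> 1\<close> the factor \<open>q ^ s - 1\<close> cancels.\<close>

lemma qbracket_root_mult:
  assumes "s \<noteq> 0" and root: "q ^ s = 1 \<longrightarrow> q = 1" and x: "of_nat s * x = of_int m"
  shows "qbracket q (int s) * qbracket_root q s x = qbracket q m"
proof (cases "q = 1")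
  case True
  have "of_nat s * (of_rat x :: complex) = of_rat (of_nat s * x)"
    by (simp add: of_rat_mult)
  also have "\<dots> = of_int m"
    by (simp add: x)
  finally show ?thesis
    using True by (simp add: qbracket_def qbracket_root_def)
next
  case False
  with root show ?thesis
    by (simp add: qbracket_def qbracket_root_def x)
qed

theorem corollary13:
  fixes s n k :: nat and h q :: complex
  assumes "h \<noteq> 0"
    and "q \<noteq> 0"
    and "q = 1 \<or> (\<forall>m::nat. m > 0 \<longrightarrow> q ^ m \<noteq> 1)"
    and "k \<le> n"
  shows "(s \<noteq> 1 \<and> s \<noteq> 0 \<longrightarrow>
           gstirling s h q n k =
             h ^ (n - k) * qbracket q (int s) ^ n
               / (qfact (q powi (1 - int s)) k * qbracket q (1 - int s) ^ k)
             * (\<Sum>j=0..k. (-1) ^ (k - j)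
                  * q powi (int ((k - j) choose 2) * (1 - int s))
                  * qbinomial (q powi (1 - int s)) k j
                  * (\<Prod>t=1..n. qbracket_root q s
                       (of_nat j / of_nat s + of_nat t - of_nat j - 1))))
       \<and> (s = 0 \<longrightarrow>
           gstirling 0 h q n k =
             h ^ (n - k) / qfact q k
             * (\<Sum>j=0..k. (-1) ^ (k - j)
                  * q ^ ((k - j) choose 2)
                  * qbinomial q k j
                  * qbracket q (int j) ^ n))"
proof -
  have root: "q powi i = 1 \<longrightarrow> q = 1" if "i \<noteq> 0" for i
    using assms(3) power_int_neq_1[OF _ that] by blast
  have bracket: "qbracket q i \<noteq> 0" if "i \<noteq> 0" for i
    using root[OF that] that by (auto simp: qbracket_def)
  \<comment> \<open>One formula serves \<open>s = 0\<close> and \<open>s > 1\<close>: all that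
    matters is that \<open>d = 1 - s\<close> is nonzero, so that no bracket in a denominator
    vanishes.\<close>
  have main: "gstirling s h q n k = h ^ (n - k) *
      ((\<Sum>j=0..k. (-1) ^ (k - j) * q powi (int ((k - j) choose 2) * (1 - int s))
         * qbinomial (q powi (1 - int s)) k j
         * (\<Prod>t<n. qbracket q (int s * int t + (1 - int s) * int j)))
       / (qfact (q powi (1 - int s)) k * qbracket q (1 - int s) ^ k))" if "s \<noteq> 1"
  proof -
    have d: "1 - int s \<noteq> 0" using that by simp
    then have nz: "qbracket q ((1 - int s) * int i) \<noteq> 0" if "i > 0" for i
      using that by (intro bracket) simp
    show ?thesis
      using gstirling_alt_sum[OF assms(2) nz refl assms(1,4)]
        alt_sum_qbinomial[OF assms(2) nz root[OF d], of "int s" n k] by simp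
  qed
  have "gstirling s h q n k =
      h ^ (n - k) * qbracket q (int s) ^ n
        / (qfact (q powi (1 - int s)) k * qbracket q (1 - int s) ^ k)
      * (\<Sum>j=0..k. (-1) ^ (k - j)
           * q powi (int ((k - j) choose 2) * (1 - int s))
           * qbinomial (q powi (1 - int s)) k j
           * (\<Prod>t=1..n. qbracket_root q s
                (of_nat j / of_nat s + of_nat t - of_nat j - 1)))" if "s \<noteq> 1" "s \<noteq> 0"
  proof -
    have P: "(\<Prod>t<n. qbracket q (int s * int t + (1 - int s) * int j))
        = qbracket q (int s) ^ n
          * (\<Prod>t=1..n. qbracket_root q s (of_nat j / of_nat s + of_nat t - of_nat j - 1))" for j
    proof -
      \<comment> \<open>\<open>Suc t\<close> appears because the product in the theorem starts at 1;
        each of the \<open>n\<close> factors releases one \<open>[s]_q\<close>.\<close>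
      have "qbracket q (int s * int t + (1 - int s) * int j)
          = qbracket q (int s) * qbracket_root q s (of_nat j / of_nat s + of_nat (Suc t) - of_nat j - 1)"
        for t
      proof (rule qbracket_root_mult[symmetric])
        show "q ^ s = 1 \<longrightarrow> q = 1" using root[of "int s"] that by simp
        show "of_nat s * (of_nat j / of_nat s + of_nat (Suc t) - of_nat j - 1 :: rat)
            = of_int (int s * int t + (1 - int s) * int j)"
          using that by (simp add: field_simps)
      qed (fact that(2))
      then have "(\<Prod>t<n. qbracket q (int s * int t + (1 - int s) * int j))
          = (\<Prod>t<n. qbracket q (int s)
              * qbracket_root q s (of_nat j / of_nat s + of_nat (Suc t) - of_nat j - 1))"
        by (simp only:)
      also have "\<dots> = qbracket q (int s) ^ n
          * (\<Prod>t<n. qbracket_root q s (of_nat j / of_nat s + of_nat (Suc t) - of_nat j - 1))"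
        by (simp only: prod.distrib prod_constant card_lessThan)
      also have "(\<Prod>t<n. qbracket_root q s (of_nat j / of_nat s + of_nat (Suc t) - of_nat j - 1))
          = (\<Prod>t=1..n. qbracket_root q s (of_nat j / of_nat s + of_nat t - of_nat j - 1))"
        by (simp only: One_nat_def prod.atLeast1_atMost_eq)
      finally show ?thesis .
    qed
    show ?thesis
      unfolding main[OF that(1)] P
      by (simp only: times_divide_eq_right times_divide_eq_left sum_distrib_left
            sum_divide_distrib mult_ac)
  qed
  moreover have "gstirling 0 h q n k =
      h ^ (n - k) / qfact q k
      * (\<Sum>j=0..k. (-1) ^ (k - j) * q ^ ((k - j) choose 2) * qbinomial q k j
           * qbracket q (int j) ^ n)" if "s = 0"
  proof -
    \<comment> \<open>Now \<open>d = 1\<close>: the power of \<open>[d]_q\<close> in the denominator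
      is 1, and every factor of the product is \<open>[j]_q\<close>, independent of
      \<open>t\<close>.\<close>
    have "qbracket q 1 = 1" by (simp add: qbracket_def)
    then show ?thesis using main that by simp
  qed
  ultimately show ?thesis by blast
qed

end
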